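(* For all integers $n\ge p\ge 2$, the number of $\alpha\in\mathcal{DP}_n$ with $h(\alpha)=p$ is $$\frac{2(2n-p+1)}{p+1}\binom{n}{p}.$$
   Context: Let $X_n=\{1,2,\dots,n\}$ and let $\mathcal{I}_n$ be the set of all partial injective maps of $X_n$ (including the empty map). $\mathcal{DP}_n$ is the set of all $\alpha\in\mathcal{I}_n$ with $|x-y|=|x\alpha-y\alpha|$ for all $x,y\in\mathrm{Dom}\,\alpha$ (partial isometries; $x\alpha$ denotes the image of $x$ under $\alpha$). The height of $\alpha$ is $h(\alpha)=|\mathrm{Im}\,\alpha|$. *)

theory Defs
  imports Complex_Main
begin

definition X :: "nat \<Rightarrow> nat set" where
  "X n = {1..n}"

definition partial_injections :: "nat \<Rightarrow> (nat \<rightharpoonup> nat) set" where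
  "partial_injections n =
     {\<alpha>. dom \<alpha> \<subseteq> X n \<and> ran \<alpha> \<subseteq> X n \<and> inj_on \<alpha> (dom \<alpha>)}"

definition DP :: "nat \<Rightarrow> (nat \<rightharpoonup> nat) set" where
  "DP n = {\<alpha> \<in> partial_injections n.
     \<forall>x \<in> dom \<alpha>. \<forall>y \<in> dom \<alpha>.
       \<bar>int x - int y\<bar> = \<bar>int (the (\<alpha> x)) - int (the (\<alpha> y))\<bar>}"

definition height :: "(nat \<rightharpoonup> nat) \<Rightarrow> nat" where
  "height \<alpha> = card (ran \<alpha>)"

end

theory Submission
  imports Defs
begin

text \<open>
  A partial isometry with at least two points in its domain is the restriction of exactly one
  translation or reflection of the integers. For a fixed rigid motion with offset \<open>d\<close>, the points
  of \<open>X n\<close> that stay in \<open>X n\<close> form an interval of size \<open>n - \<bar>d\<bar>\<close>, so it contributes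
  \<open>(n - \<bar>d\<bar>) choose p\<close> partial isometries of height \<open>p\<close>. Summing over \<open>d\<close> and the two
  orientations gives \<open>2 * (n choose p) + 4 * (n choose (p + 1))\<close>.
\<close>

text \<open>Reflections are taken about the centre of \<open>X n\<close> before shifting, so that both kinds of motion
  keep \<open>n - \<bar>d\<bar>\<close> points inside \<open>X n\<close>.\<close>

definition motion :: "nat \<Rightarrow> bool \<Rightarrow> int \<Rightarrow> nat \<Rightarrow> int" where
  "motion n r d x = (if r then int n + 1 - int x else int x) + d"

definition stay :: "nat \<Rightarrow> bool \<Rightarrow> int \<Rightarrow> nat set" where
  "stay n r d = {x \<in> X n. 1 \<le> motion n r d x \<and> motion n r d x \<le> int n}"

definition restricted_motion :: "nat \<Rightarrow> bool \<Rightarrow> int \<Rightarrow> nat set \<Rightarrow> nat \<rightharpoonup> nat" where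
  "restricted_motion n r d A = (\<lambda>x. if x \<in> A then Some (nat (motion n r d x)) else None)"

text \<open>The offsets \<open>n\<close> and \<open>- n\<close> leave no point inside
  \<open>X n\<close>; with them, \<open>n - \<bar>d\<bar>\<close> runs through every
  \<open>m < n\<close> on each side of \<open>0\<close>.\<close>

definition motion_data :: "nat \<Rightarrow> nat \<Rightarrow> ((bool \<times> int) \<times> nat set) set" where
  "motion_data n p =
     (SIGMA (r, d) : UNIV \<times> {- int n..int n}. {A. A \<subseteq> stay n r d \<and> card A = p})"

lemma card_ge_2E:
  assumes "2 \<le> card A"
  obtains x y where "x \<in> A" "y \<in> A" "x \<noteq> y"
proof -
  have "finite A"
    using assms by (intro card_ge_0_finite) simp
  then show thesis
    using assms that card_le_Suc0_iff_eq[of A] by fastforce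
qed

lemma finite_stay: "finite (stay n r d)"
  by (simp add: stay_def X_def)

lemma card_stay:
  assumes "\<bar>d\<bar> \<le> int n"
  shows "card (stay n r d) = n - nat \<bar>d\<bar>"
proof -
  \<comment> \<open>A nonzero shift pushes \<open>\<bar>d\<bar>\<close> points past one end. Upward
    translations and downward-shifted reflections lose the largest points, the other two kinds the
    smallest.\<close>
  have "stay n r d =
      (if (d \<le> 0) = r then {1..n - nat \<bar>d\<bar>} else {Suc (nat \<bar>d\<bar>)..n})" if "d \<noteq> 0"
    using assms that by (auto simp: stay_def motion_def X_def)
  moreover have "stay n r d = {1..n}" if "d = 0"
    using that by (auto simp: stay_def motion_def X_def)
  ultimately show ?thesis
    by (cases "d = 0") auto
qed

lemma dom_restricted_motion: "dom (restricted_motion n r d A) = A"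
  by (auto simp: restricted_motion_def dom_def)

text \<open>The domain recovers \<open>A\<close>. On two distinct points a translation keeps the
  sign of the difference and a reflection flips it, which fixes \<open>r\<close>; one value then
  fixes \<open>d\<close>.\<close>

lemma restricted_motion_eqD:
  assumes "A \<subseteq> stay n r d" "A' \<subseteq> stay n r' d'" "2 \<le> card A"
    and eq: "restricted_motion n r d A = restricted_motion n r' d' A'"
  shows "r = r' \<and> d = d' \<and> A = A'"
proof -
  have A: "A = A'"
    using eq dom_restricted_motion by metis
  obtain x y where xy: "x \<in> A" "y \<in> A" "x \<noteq> y"
    using assms(3) by (rule card_ge_2E)
  have "motion n r d z = motion n r' d' z" if "z \<in> A" for z
  proof -
    have "nat (motion n r d z) = nat (motion n r' d' z)"
      using fun_cong[OF eq, of z] that A by (simp add: restricted_motion_def)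
    \<comment> \<open>Positivity makes \<open>nat\<close> injective on these values.\<close>
    moreover have "1 \<le> motion n r d z" "1 \<le> motion n r' d' z"
      using that assms(1,2) A by (auto simp: stay_def)
    ultimately show ?thesis by linarith
  qed
  from this[OF xy(1)] this[OF xy(2)] xy(3) have "r = r' \<and> d = d'"
    by (auto simp: motion_def split: if_splits)
  with A show ?thesis by simp
qed

lemma height_eq_card_dom:
  assumes "\<alpha> \<in> DP n"
  shows "height \<alpha> = card (dom \<alpha>)"
proof -
  have "inj_on \<alpha> (dom \<alpha>)"
    using assms by (simp add: DP_def partial_injections_def)
  then have "inj_on (the \<circ> \<alpha>) (dom \<alpha>)"
    by (auto simp: inj_on_def dom_def)
  moreover have "ran \<alpha> = (the \<circ> \<alpha>) ` dom \<alpha>"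
    by (force simp: ran_def dom_def)
  ultimately show ?thesis
    unfolding height_def by (metis card_image)
qed

lemma restricted_motion_in_DP:
  assumes "A \<subseteq> stay n r d"
  shows "restricted_motion n r d A \<in> DP n"
proof -
  let ?\<alpha> = "restricted_motion n r d A"
  have bounds: "1 \<le> motion n r d x" "motion n r d x \<le> int n" "x \<in> X n" if "x \<in> A" for x
    using that assms by (auto simp: stay_def)
  have val: "?\<alpha> x = Some (nat (motion n r d x))" if "x \<in> A" for x
    using that by (simp add: restricted_motion_def)
  have dist: "\<bar>int x - int y\<bar> = \<bar>int (the (?\<alpha> x)) - int (the (?\<alpha> y))\<bar>"
    if "x \<in> A" "y \<in> A" for x y
    using bounds(1)[OF that(1)] bounds(1)[OF that(2)] that
    by (auto simp: val motion_def)
  \<comment> \<open>Equal images are at distance 0, hence so are the points.\<close>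
  have "inj_on ?\<alpha> A"
  proof (rule inj_onI)
    fix x y assume "x \<in> A" "y \<in> A" "?\<alpha> x = ?\<alpha> y"
    then show "x = y" using dist[of x y] by simp
  qed
  moreover have "ran ?\<alpha> \<subseteq> X n"
  proof
    fix w assume "w \<in> ran ?\<alpha>"
    then obtain x where "x \<in> A" "w = nat (motion n r d x)"
      by (auto simp: ran_def restricted_motion_def split: if_splits)
    then show "w \<in> X n" using bounds[of x] by (auto simp: X_def)
  qed
  ultimately show ?thesis
    using dist bounds(3) by (auto simp: DP_def partial_injections_def dom_restricted_motion)
qed

text \<open>Two points of the domain select the motion, and a point of the line is determined by its
  distances to two distinct points.\<close>

lemma DP_eq_restricted_motion:
  assumes "\<alpha> \<in> DP n" "2 \<le> card (dom \<alpha>)"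
  obtains r d where "\<bar>d\<bar> \<le> int n" "dom \<alpha> \<subseteq> stay n r d"
    "\<alpha> = restricted_motion n r d (dom \<alpha>)"
proof -
  define f where "f x = int (the (\<alpha> x))" for x
  have iso: "\<bar>int x - int y\<bar> = \<bar>f x - f y\<bar>" if "x \<in> dom \<alpha>" "y \<in> dom \<alpha>" for x y
    using assms(1) that by (simp add: DP_def f_def)
  have range: "1 \<le> x" "x \<le> n" "1 \<le> f x" "f x \<le> int n" if "x \<in> dom \<alpha>" for x
  proof -
    have "x \<in> X n" "the (\<alpha> x) \<in> X n"
      using assms(1) that by (auto simp: DP_def partial_injections_def ran_def dom_def)
    then show "1 \<le> x" "x \<le> n" "1 \<le> f x" "f x \<le> int n"
      by (auto simp: X_def f_def)
  qed
  obtain x y where xy: "x \<in> dom \<alpha>" "y \<in> dom \<alpha>" "x \<noteq> y"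
    using assms(2) by (rule card_ge_2E)
  define r where "r \<longleftrightarrow> f x - f y \<noteq> int x - int y"
  \<comment> \<open>Solves \<open>motion n r d x = f x\<close>; the choice of \<open>r\<close> then
    gives agreement at \<open>y\<close> too.\<close>
  define d where "d = (if r then f x + int x - int n - 1 else f x - int x)"
  \<comment> \<open>Both sides have the same distances to the distinct values \<open>f x\<close> and
    \<open>f y\<close>.\<close>
  have motion: "motion n r d z = f z" if "z \<in> dom \<alpha>" for z
    using iso[OF xy(1,2)] iso[OF that xy(1)] iso[OF that xy(2)] xy(3)
    by (simp add: motion_def d_def r_def) linarith
  show thesis
  proof
    show "\<bar>d\<bar> \<le> int n"
      using range[OF xy(1)] by (auto simp: d_def)
    show "dom \<alpha> \<subseteq> stay n r d"
    proof
      fix z assume "z \<in> dom \<alpha>"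
      from range[OF this] motion[OF this] show "z \<in> stay n r d"
        by (simp add: stay_def X_def)
    qed
    show "\<alpha> = restricted_motion n r d (dom \<alpha>)"
    proof
      fix z show "\<alpha> z = restricted_motion n r d (dom \<alpha>) z"
        using motion[of z] by (auto simp: restricted_motion_def f_def dom_def)
    qed
  qed
qed

lemma bij_betw_restricted_motion:
  assumes "2 \<le> p"
  shows "bij_betw (\<lambda>((r, d), A). restricted_motion n r d A)
           (motion_data n p) {\<alpha> \<in> DP n. height \<alpha> = p}"
proof (rule bij_betw_imageI)
  show "inj_on (\<lambda>((r, d), A). restricted_motion n r d A) (motion_data n p)"
  proof (rule inj_onI)
    fix u v
    assume uv: "u \<in> motion_data n p" "v \<in> motion_data n p"
      "(\<lambda>((r, d), A). restricted_motion n r d A) u =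
       (\<lambda>((r, d), A). restricted_motion n r d A) v"
    obtain r d A r' d' A' where "u = ((r, d), A)" "v = ((r', d'), A')"
      by (metis surj_pair)
    with uv assms show "u = v"
      using restricted_motion_eqD[of A n r d A' r' d'] by (simp add: motion_data_def)
  qed
  show "(\<lambda>((r, d), A). restricted_motion n r d A) ` motion_data n p = {\<alpha> \<in> DP n. height \<alpha> = p}"
  proof (intro equalityI subsetI)
    fix \<alpha> assume "\<alpha> \<in> (\<lambda>((r, d), A). restricted_motion n r d A) ` motion_data n p"
    then show "\<alpha> \<in> {\<alpha> \<in> DP n. height \<alpha> = p}"
      by (auto simp: motion_data_def restricted_motion_in_DP dom_restricted_motion
          height_eq_card_dom[OF restricted_motion_in_DP])
  next
    fix \<alpha> assume "\<alpha> \<in> {\<alpha> \<in> DP n. height \<alpha> = p}"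
    then have \<alpha>: "\<alpha> \<in> DP n" "card (dom \<alpha>) = p"
      by (auto simp: height_eq_card_dom)
    with assms obtain r d where "\<bar>d\<bar> \<le> int n" "dom \<alpha> \<subseteq> stay n r d"
      "\<alpha> = restricted_motion n r d (dom \<alpha>)"
      by (metis DP_eq_restricted_motion)
    with \<alpha> show "\<alpha> \<in> (\<lambda>((r, d), A). restricted_motion n r d A) ` motion_data n p"
      by (intro image_eqI[of _ _ "((r, d), dom \<alpha>)"]) (auto simp: motion_data_def)
  qed
qed

text \<open>The hockey-stick identity; the induction step is Pascal's rule.\<close>

lemma sum_choose_lessThan: "(\<Sum>m<n. m choose p) = n choose Suc p"
  by (induction n) auto

text \<open>The offsets \<open>d\<close> and \<open>- d\<close> contribute equally, so
  \<open>m = n - \<bar>d\<bar>\<close> occurs twice for each \<open>m < n\<close> and once for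
  \<open>m = n\<close>.\<close>

lemma sum_symmetric_interval:
  fixes g :: "nat \<Rightarrow> nat"
  shows "(\<Sum>d\<in>{- int n..int n}. g (n - nat \<bar>d\<bar>)) = g n + 2 * (\<Sum>m<n. g m)"
proof -
  have split: "{- int n..int n} = insert 0 ({1..int n} \<union> {- int n..-1})"
    by auto
  have "(\<Sum>d\<in>{1..int n}. g (n - nat \<bar>d\<bar>)) = (\<Sum>m<n. g m)"
    by (rule sum.reindex_bij_witness[where i = "\<lambda>m. int n - int m" and j = "\<lambda>d. n - nat \<bar>d\<bar>"]) auto
  moreover have "(\<Sum>d\<in>{- int n..-1}. g (n - nat \<bar>d\<bar>)) = (\<Sum>m<n. g m)"
    by (rule sum.reindex_bij_witness[where i = "\<lambda>m. int m - int n" and j = "\<lambda>d. n - nat \<bar>d\<bar>"]) auto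
  ultimately show ?thesis
    unfolding split by (subst sum.insert) (auto simp: sum.union_disjoint)
qed

lemma card_motion_data:
  "card (motion_data n p) = 2 * (n choose p) + 4 * (n choose Suc p)"
proof -
  have "card (motion_data n p) =
      (\<Sum>(r, d)\<in>UNIV \<times> {- int n..int n}. card {A. A \<subseteq> stay n r d \<and> card A = p})"
    unfolding motion_data_def
    by (subst card_SigmaI) (auto simp: finite_stay intro!: sum.cong)
  also have "\<dots> = (\<Sum>(r :: bool, d)\<in>UNIV \<times> {- int n..int n}. (n - nat \<bar>d\<bar>) choose p)"
    by (intro sum.cong) (auto simp: n_subsets finite_stay card_stay)
  \<comment> \<open>The summand does not depend on the orientation \<open>r\<close>, which takes two
    values.\<close>
  also have "\<dots> = 2 * (\<Sum>d\<in>{- int n..int n}. (n - nat \<bar>d\<bar>) choose p)"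
    by (simp add: sum.cartesian_product[symmetric])
  finally show ?thesis
    by (simp add: sum_symmetric_interval[of "\<lambda>m. m choose p"] sum_choose_lessThan)
qed

theorem proposition3p15:
  fixes n p :: nat
  assumes "n \<ge> p" and "p \<ge> 2"
  shows "real (card {\<alpha> \<in> DP n. height \<alpha> = p}) =
    2 * (2 * real n - real p + 1) / (real p + 1) * real (n choose p)"
proof -
  have "card {\<alpha> \<in> DP n. height \<alpha> = p} = 2 * (n choose p) + 4 * (n choose Suc p)"
    using bij_betw_same_card[OF bij_betw_restricted_motion[OF assms(2)]] card_motion_data by metis
  then have card: "real (card {\<alpha> \<in> DP n. height \<alpha> = p}) =
      2 * real (n choose p) + 4 * real (n choose Suc p)"
    by simp
  \<comment> \<open>Absorption; splitting \<open>Suc n choose Suc p\<close> by Pascal's rule leaves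
    a linear relation between \<open>n choose Suc p\<close> and \<open>n choose p\<close>.\<close>
  have "real (Suc n * (n choose p)) = real ((Suc n choose Suc p) * Suc p)"
    by (simp only: Suc_times_binomial_eq)
  then have "(real p + 1) * real (n choose Suc p) = (real n - real p) * real (n choose p)"
    by (simp add: algebra_simps)
  then have "real (n choose Suc p) = (real n - real p) * real (n choose p) / (real p + 1)"
    by (simp add: field_simps)
  then show ?thesis
    unfolding card by (simp add: field_simps)
qed

end
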